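(* Let $c_1,c_2,c_3>0$ and $Z\in\mathbb R$. Consider functions $\Phi_Z=(\phi_1,\phi_2,\phi_3)$ of kink type, $$\phi_1(x)=4\arctan\left(e^{(x-a_1)/c_1}\right)\ (x<0),\qquad \phi_j(x)=4\arctan\left(e^{-(x-a_j)/c_j}\right)\ (x>0,\ j=2,3),$$ with $a_1,a_2,a_3\in\mathbb R$. Such a $\Phi_Z$ belongs to $$D(\mathcal L_Z)=\Big\{\mathbf v\in H^2(\mathcal Y):v_1(0-)=v_2(0+)=v_3(0+),\ \sum_{j=2}^3c_j^2v_j'(0+)-c_1^2v_1'(0-)=Zv_1(0-)\Big\}$$ only for parameter values $Z\in\left(-\sum_{j=1}^3c_j,\,0\right)$. In particular, there is no kink profile of this form compatible with the Kirchhoff condition, i.e. with the vertex conditions for $Z=0$.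
   Context: $\mathcal Y$ is the metric graph with edges $E_1=(-\infty,0)$, $E_2=E_3=(0,\infty)$ joined at the vertex $\nu=0$, and $H^2(\mathcal Y)=H^2(-\infty,0)\oplus H^2(0,\infty)\oplus H^2(0,\infty)$. *)

theory Defs
  imports "HOL-Analysis.Analysis"
begin

text \<open>
  Functions on an open interval \<open>I\<close> are represented by total functions on the reals; their values
  outside \<open>I\<close> are irrelevant, and so are their values on null subsets of \<open>I\<close>.
\<close>

definition square_integrable_on :: "real set \<Rightarrow> (real \<Rightarrow> real) \<Rightarrow> bool" where
  "square_integrable_on I f \<longleftrightarrow>
     set_borel_measurable lebesgue I f \<and> set_integrable lebesgue I (\<lambda>x. (f x)\<^sup>2)"

definition test_function_on :: "real set \<Rightarrow> (real \<Rightarrow> real) \<Rightarrow> bool" where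
  "test_function_on I \<phi> \<longleftrightarrow>
     (\<forall>n x. ((deriv ^^ n) \<phi>) differentiable (at x)) \<and>
     (\<exists>K. compact K \<and> K \<subseteq> I \<and> (\<forall>x. x \<notin> K \<longrightarrow> \<phi> x = 0))"

definition weak_derivative_on :: "real set \<Rightarrow> (real \<Rightarrow> real) \<Rightarrow> (real \<Rightarrow> real) \<Rightarrow> bool" where
  "weak_derivative_on I f g \<longleftrightarrow>
     (\<forall>\<phi>. test_function_on I \<phi> \<longrightarrow>
        (LINT x:I|lebesgue. f x * deriv \<phi> x) = - (LINT x:I|lebesgue. g x * \<phi> x))"

definition H2 :: "real set \<Rightarrow> (real \<Rightarrow> real) set" where
  "H2 I = {f. \<exists>g h. square_integrable_on I f \<and> square_integrable_on I g \<and> square_integrable_on I h \<and>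
                 weak_derivative_on I f g \<and> weak_derivative_on I g h}"

type_synonym Y_function = "(real \<Rightarrow> real) \<times> (real \<Rightarrow> real) \<times> (real \<Rightarrow> real)"

definition H2_Y :: "Y_function set" where
  "H2_Y = H2 {..<0} \<times> H2 {0<..} \<times> H2 {0<..}"

text \<open>
  One-sided values at the vertex are limits of the \<open>C\<^sup>1\<close> representative, which every element of
  \<open>H\<^sup>2\<close> has by Sobolev embedding and which is unique on \<open>I\<close>.
\<close>

definition C1_rep :: "real set \<Rightarrow> (real \<Rightarrow> real) \<Rightarrow> (real \<Rightarrow> real)" where
  "C1_rep I f = (SOME w. w C1_differentiable_on I \<and> (AE x in lebesgue. x \<in> I \<longrightarrow> w x = f x))"

definition value_left :: "(real \<Rightarrow> real) \<Rightarrow> real" where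
  "value_left f = Lim (at_left 0) (C1_rep {..<0} f)"

definition value_right :: "(real \<Rightarrow> real) \<Rightarrow> real" where
  "value_right f = Lim (at_right 0) (C1_rep {0<..} f)"

definition slope_left :: "(real \<Rightarrow> real) \<Rightarrow> real" where
  "slope_left f = Lim (at_left 0) (deriv (C1_rep {..<0} f))"

definition slope_right :: "(real \<Rightarrow> real) \<Rightarrow> real" where
  "slope_right f = Lim (at_right 0) (deriv (C1_rep {0<..} f))"

definition vertex_conditions :: "real \<Rightarrow> real \<Rightarrow> real \<Rightarrow> real \<Rightarrow> Y_function \<Rightarrow> bool" where
  "vertex_conditions c1 c2 c3 Z = (\<lambda>(v1, v2, v3).
     value_left v1 = value_right v2 \<and> value_right v2 = value_right v3 \<and>
     c2\<^sup>2 * slope_right v2 + c3\<^sup>2 * slope_right v3 - c1\<^sup>2 * slope_left v1 = Z * value_left v1)"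

definition domain_L :: "real \<Rightarrow> real \<Rightarrow> real \<Rightarrow> real \<Rightarrow> Y_function set" where
  "domain_L c1 c2 c3 Z = {v \<in> H2_Y. vertex_conditions c1 c2 c3 Z v}"

definition kink_profile ::
  "real \<Rightarrow> real \<Rightarrow> real \<Rightarrow> real \<Rightarrow> real \<Rightarrow> real \<Rightarrow> Y_function" where
  "kink_profile c1 c2 c3 a1 a2 a3 =
     ((\<lambda>x. 4 * arctan (exp ((x - a1) / c1))),
      (\<lambda>x. 4 * arctan (exp (- (x - a2) / c2))),
      (\<lambda>x. 4 * arctan (exp (- (x - a3) / c3))))"

end

(* Replacing each profile by its C^1 representative does not change it, so with y the common value
   of the three exponentials at the vertex (arctan is injective) the flux condition reads
   -(c1 + c2 + c3) y / (1 + y^2) = Z arctan y, and 0 < y / (1 + y^2) < arctan y for y > 0. *)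
theory Submission
  imports Defs
begin

text \<open>The points of \<open>I\<close> where \<open>f\<close> and \<open>g\<close> differ form
  an open null set, and a nonempty open set has positive Lebesgue measure.\<close>

lemma AE_eq_continuous_imp_eq:
  fixes f g :: "'a::euclidean_space \<Rightarrow> 'b::real_normed_vector"
  assumes "open I" "continuous_on I f" "continuous_on I g"
    and ae: "AE x in lebesgue. x \<in> I \<longrightarrow> f x = g x" and "x \<in> I"
  shows "f x = g x"
proof (rule ccontr)
  let ?U = "I \<inter> (\<lambda>x. f x - g x) -` (- {0})"
  assume "f x \<noteq> g x"
  then have "x \<in> ?U"
    using \<open>x \<in> I\<close> by simp
  moreover have "open ?U"
    using assms by (intro continuous_open_preimage continuous_intros) auto
  moreover have "AE x\<in>?U in lebesgue. x \<in> {}"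
    using ae by eventually_elim auto
  ultimately show False
    using mem_closed_if_AE_lebesgue_open[of ?U "{}" x] by simp
qed

text \<open>\<open>f\<close> itself witnesses the choice in \<open>C1_rep\<close>; whatever is
  chosen is continuous and agrees with \<open>f\<close> almost everywhere, hence everywhere on
  \<open>I\<close>.\<close>

lemma C1_rep_eq:
  assumes "open I" "f C1_differentiable_on I" "x \<in> I"
  shows "C1_rep I f x = f x"
proof -
  have "C1_rep I f C1_differentiable_on I \<and> (AE x in lebesgue. x \<in> I \<longrightarrow> C1_rep I f x = f x)"
    unfolding C1_rep_def by (rule someI[of _ f]) (use assms in auto)
  then show ?thesis
    using assms AE_eq_continuous_imp_eq C1_differentiable_imp_continuous_on by blast
qed

lemma deriv_C1_rep_eq:
  assumes "open I" "f C1_differentiable_on I" "x \<in> I"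
  shows "deriv (C1_rep I f) x = deriv f x"
  using assms C1_rep_eq by (intro deriv_cong_ev eventually_nhds_in_open[THEN eventually_mono]) auto

text \<open>Since \<open>f\<close> is C^1 on the whole line, one-sided limits at \<open>a\<close>
  are ordinary values there. The filter \<open>at a within I\<close> covers both
  \<open>at_left 0\<close> and \<open>at_right 0\<close>.\<close>

lemma Lim_C1_rep:
  assumes f: "\<And>x. (f has_real_derivative D x) (at x)" and D: "continuous_on UNIV D"
    and I: "open I" "at a within I \<noteq> bot"
  shows "Lim (at a within I) (C1_rep I f) = f a"
    and "Lim (at a within I) (deriv (C1_rep I f)) = D a"
proof -
  have C1: "f C1_differentiable_on I"
    unfolding C1_differentiable_on_def
    using f continuous_on_subset[OF D subset_UNIV]
    by (auto simp: has_real_derivative_iff_has_vector_derivative)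
  have inI: "\<forall>\<^sub>F x in at a within I. x \<in> I"
    by (simp add: eventually_at_filter)
  have "(f \<longlongrightarrow> f a) (at a within I)"
    using DERIV_isCont[OF f] by (simp add: continuous_at_imp_continuous_at_within flip: continuous_within)
  then have "(C1_rep I f \<longlongrightarrow> f a) (at a within I)"
    by (rule Lim_transform_eventually) (use inI C1_rep_eq[OF I(1) C1] in \<open>auto elim: eventually_mono\<close>)
  then show "Lim (at a within I) (C1_rep I f) = f a"
    by (rule tendsto_Lim[OF I(2)])
  have "(D \<longlongrightarrow> D a) (at a within I)"
    using D by (simp add: continuous_on_eq_continuous_at continuous_at_imp_continuous_at_within
        flip: continuous_within)
  moreover have "\<forall>\<^sub>F x in at a within I. D x = deriv (C1_rep I f) x"
    using inI
    by eventually_elim (simp add: deriv_C1_rep_eq[OF I(1) C1] DERIV_imp_deriv[OF f])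
  ultimately have "(deriv (C1_rep I f) \<longlongrightarrow> D a) (at a within I)"
    by (rule Lim_transform_eventually)
  then show "Lim (at a within I) (deriv (C1_rep I f)) = D a"
    by (rule tendsto_Lim[OF I(2)])
qed

text \<open>The common shape of the three profiles: \<open>r\<close> is \<open>1 / c1\<close>,
  \<open>- 1 / c2\<close> or \<open>- 1 / c3\<close>, and \<open>exp b\<close> is the exponential at
  the vertex.\<close>

lemma kink_vertex_values:
  fixes r b :: real
  defines "f \<equiv> \<lambda>x. 4 * arctan (exp (r * x + b))"
  shows "value_left f = 4 * arctan (exp b)"
    and "value_right f = 4 * arctan (exp b)"
    and "slope_left f = 4 * r * (exp b / (1 + (exp b)\<^sup>2))"
    and "slope_right f = 4 * r * (exp b / (1 + (exp b)\<^sup>2))"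
proof -
  let ?D = "\<lambda>x. 4 * r * (exp (r * x + b) / (1 + (exp (r * x + b))\<^sup>2))"
  have pos: "1 + (exp t)\<^sup>2 \<noteq> 0" for t :: real
    by (metis add_pos_nonneg less_irrefl zero_le_power2 zero_less_one)
  have f: "(f has_real_derivative ?D x) (at x)" for x
    unfolding f_def by (auto intro!: derivative_eq_intros simp: field_simps)
  have D: "continuous_on UNIV ?D"
    by (intro continuous_intros) (use pos in auto)
  note L = Lim_C1_rep[OF f D]
  show "value_left f = 4 * arctan (exp b)" "value_right f = 4 * arctan (exp b)"
    "slope_left f = 4 * r * (exp b / (1 + (exp b)\<^sup>2))"
    "slope_right f = 4 * r * (exp b / (1 + (exp b)\<^sup>2))"
    unfolding value_left_def value_right_def slope_left_def slope_right_def
    using L[of "{..<0}" 0] L[of "{0<..}" 0] by (simp_all add: f_def)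
qed

text \<open>With \<open>t = arctan y\<close> the left side is sin t cos t, and sin t cos t < sin t
  \<le> t because sin t > 0 and cos t < 1.\<close>

lemma div_one_plus_square_less_arctan:
  fixes y :: real
  assumes "y > 0"
  shows "y / (1 + y\<^sup>2) < arctan y"
proof -
  have "y / (1 + y\<^sup>2) = sin (arctan y) * cos (arctan y)"
    by (simp add: sin_arctan cos_arctan)
  also have "\<dots> < sin (arctan y)"
  proof -
    have "sin (arctan y) > 0"
      using assms by (simp add: sin_arctan add_pos_nonneg)
    moreover have "cos (arctan y) < 1"
      using assms by (simp add: cos_arctan add_pos_nonneg)
    ultimately show ?thesis
      by simp
  qed
  also have "\<dots> \<le> arctan y"
    using assms by (simp add: sin_x_le_x)
  finally show ?thesis .
qed

text \<open>Stated for the vertex conditions rather than for \<open>domain_L\<close>, so that it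
  serves the Kirchhoff claim as well.\<close>

lemma vertex_conditions_kink_profile_imp:
  assumes c: "c1 > 0" "c2 > 0" "c3 > 0"
    and v: "vertex_conditions c1 c2 c3 Z (kink_profile c1 c2 c3 a1 a2 a3)"
  shows "Z \<in> {- (c1 + c2 + c3) <..< 0}"
proof -
  define y where "y = exp (- a1 / c1)"
  define q where "q = y / (1 + y\<^sup>2)"
  \<comment> \<open>Brings the exponents into the form \<open>r * x + b\<close> on which
    \<open>kink_vertex_values\<close> rewrites.\<close>
  have affine: "(x - a) / c = 1 / c * x + - a / c" "- (x - a) / c = - 1 / c * x + a / c"
    for x a c :: real
    by (simp_all add: diff_divide_distrib add_divide_distrib)
  note v' = v[unfolded vertex_conditions_def kink_profile_def affine prod.case kink_vertex_values]
  have y: "exp (a2 / c2) = y" "exp (a3 / c3) = y"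
    using v' by (simp_all add: y_def arctan_eq_iff)
  \<comment> \<open>The flux condition: the weight \<open>c\<^sup>2\<close> against a slope factor
    of size \<open>1 / c\<close> leaves \<open>c\<close>, and all three edges contribute with a
    minus sign.\<close>
  have "c2\<^sup>2 * (4 * (- 1 / c2) * q) + c3\<^sup>2 * (4 * (- 1 / c3) * q) - c1\<^sup>2 * (4 * (1 / c1) * q)
      = Z * (4 * arctan y)"
    using v' unfolding y q_def y_def[symmetric] by blast
  then have Z: "Z * arctan y = - (c1 + c2 + c3) * q"
    using c by (simp add: power2_eq_square field_simps)
  have "y > 0"
    by (simp add: y_def)
  then have q: "0 < q" "q < arctan y"
    using div_one_plus_square_less_arctan by (auto simp: q_def add_pos_nonneg)
  have "Z * arctan y < 0"
    unfolding Z using c q by (simp add: mult_neg_pos)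
  \<comment> \<open>The negative factor \<open>- (c1 + c2 + c3)\<close> reverses
    \<open>q < arctan y\<close>; dividing by \<open>arctan y > 0\<close> then gives both bounds on
    \<open>Z\<close>.\<close>
  moreover have "- (c1 + c2 + c3) * arctan y < Z * arctan y"
    unfolding Z using c q by (intro mult_strict_left_mono_neg) auto
  ultimately show ?thesis
    using \<open>y > 0\<close> by (auto simp: mult_less_0_iff mult_less_cancel_right)
qed

theorem mainTheorem5:
  fixes c1 c2 c3 :: real
  assumes "c1 > 0" and "c2 > 0" and "c3 > 0"
  shows "(\<forall>Z a1 a2 a3. kink_profile c1 c2 c3 a1 a2 a3 \<in> domain_L c1 c2 c3 Z
            \<longrightarrow> Z \<in> {- (c1 + c2 + c3) <..< 0}) \<and>
         \<not> (\<exists>a1 a2 a3. vertex_conditions c1 c2 c3 0 (kink_profile c1 c2 c3 a1 a2 a3))"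
  \<comment> \<open>The Kirchhoff case is \<open>Z = 0\<close>, which the open interval
    excludes.\<close>
  using vertex_conditions_kink_profile_imp[OF assms] by (fastforce simp: domain_L_def)

end
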